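(* Let $G=(X,E)$ be a graph with $\alpha_p(G)=\vartheta^-(G)$. Let $R=(R_x)_{x\in X}$ be a projective packing of $G$ on a Hilbert space $H$ with $\operatorname{val}(R)=\alpha_p(G)$, and let $Q\in\mathbb R^{X\times X}$ be a dual $\vartheta^-$ certificate for $G$ at value $\vartheta^-(G)$. Then the operator-valued function $x\mapsto R_x$, seen as an element of $\mathbb C^X\otimes\operatorname{End}(H)$, lies in $\ker Q\otimes\operatorname{End}(H)$; equivalently, each of its scalar matrix entries (as a function $X\to\mathbb C$) belongs to $\ker Q\subseteq\mathbb C^X$.
   Context: Graphs are finite, undirected and loopless; Hilbert spaces are complex, nonzero and finite-dimensional; $\sim_G$ denotes adjacency. $\operatorname{End}(H)$ denotes the linear operators on $H$. A dual $\vartheta^-$ certificate for $G$ at value $\beta\in\mathbb R$ is a real symmetric matrix $Q\in\mathbb R^{X\times X}$ with $Q\succeq 0$, $Q_{xx}=\beta-1$ for all $x\in X$, and $Q_{xy}\le -1$ for all $x\neq y$ in $X$ with $x\not\sim_G y$. $\vartheta^-(G)$ is the minimum $\beta$ for which a dual $\vartheta^-$ certificate for $G$ at value $\beta$ exists. A projective packing of $G$ on $H$ is a family $R=(R_x)_{x\in X}$ of (orthogonal) projectors on $H$ with $R_xR_y=0$ whenever $x\sim_G y$. Its value is $\operatorname{val}(R)=\frac{1}{\dim H}\sum_{x\in X}\operatorname{rank}(R_x)$. The projective packing number $\alpha_p(G)$ is the supremum of $\operatorname{val}(R)$ over all projective packings $R$ of $G$ over all nonzero finite-dimensional Hilbert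 spaces. An element $\sum_i f_i\otimes A_i$ of $\mathbb C^X\otimes\operatorname{End}(H)$ is identified with the function $x\mapsto\sum_i f_i(x)A_i$. *)

theory Defs
  imports "HOL-Analysis.Analysis" "HOL-Library.Function_Algebras"
begin

text \<open>
  A graph is given by its adjacency relation, a symmetric and irreflexive relation on a finite
  type of vertices.
\<close>

definition dual_certificate :: "('x::finite \<Rightarrow> 'x \<Rightarrow> bool) \<Rightarrow> real \<Rightarrow> real^'x^'x \<Rightarrow> bool" where
  "dual_certificate adj \<beta> Q \<longleftrightarrow>
     transpose Q = Q \<and> (\<forall>v. 0 \<le> v \<bullet> (Q *v v)) \<and>
     (\<forall>x. Q $ x $ x = \<beta> - 1) \<and>
     (\<forall>x y. x \<noteq> y \<longrightarrow> \<not> adj x y \<longrightarrow> Q $ x $ y \<le> - 1)"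

text \<open>The minimum is attained: the set of feasible \<open>\<beta>\<close> is nonempty, closed and bounded below.\<close>

definition theta_minus :: "('x::finite \<Rightarrow> 'x \<Rightarrow> bool) \<Rightarrow> real" where
  "theta_minus adj = (LEAST \<beta>. \<exists>Q. dual_certificate adj \<beta> Q)"

definition complex_ker :: "real^'x^'x \<Rightarrow> (complex^'x::finite) set" where
  "complex_ker Q = {f. (\<chi> x y. complex_of_real (Q $ x $ y)) *v f = 0}"

text \<open>
  A nonzero finite-dimensional complex Hilbert space \<open>H\<close> is a subspace of an ambient complex vector
  space, with an inner product of its own. No inner product is assumed on the ambient space, which
  only supplies addition and scalar multiplication, so that spaces of different dimensions can
  share a type. Operators are functions on the ambient type, and only their values on \<open>H\<close> matter.
\<close>

locale fd_hilbert_space = vector_space scale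
  for scale :: "complex \<Rightarrow> 'h::ab_group_add \<Rightarrow> 'h" +
  fixes H :: "'h set" and ip :: "'h \<Rightarrow> 'h \<Rightarrow> complex"
  assumes subspace_H: "subspace H"
    and finite_dim_H: "\<exists>B. finite B \<and> span B = H"
    and nonzero_H: "H \<noteq> {0}"
    and ip_add_left: "\<lbrakk>u \<in> H; v \<in> H; w \<in> H\<rbrakk> \<Longrightarrow> ip (u + v) w = ip u w + ip v w"
    and ip_scale_left: "\<lbrakk>u \<in> H; v \<in> H\<rbrakk> \<Longrightarrow> ip (scale c u) v = c * ip u v"
    and ip_commute: "\<lbrakk>u \<in> H; v \<in> H\<rbrakk> \<Longrightarrow> ip v u = cnj (ip u v)"
    and ip_pos: "\<lbrakk>v \<in> H; v \<noteq> 0\<rbrakk> \<Longrightarrow> 0 < Re (ip v v)"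
begin

definition End :: "('h \<Rightarrow> 'h) set" where
  "End = {A. (\<forall>v\<in>H. A v \<in> H) \<and> (\<forall>u\<in>H. \<forall>v\<in>H. A (u + v) = A u + A v) \<and>
             (\<forall>c. \<forall>v\<in>H. A (scale c v) = scale c (A v))}"

definition projector :: "('h \<Rightarrow> 'h) \<Rightarrow> bool" where
  "projector P \<longleftrightarrow> P \<in> End \<and> (\<forall>v\<in>H. P (P v) = P v) \<and>
                  (\<forall>u\<in>H. \<forall>v\<in>H. ip (P u) v = ip u (P v))"

definition op_rank :: "('h \<Rightarrow> 'h) \<Rightarrow> nat" where
  "op_rank A = dim (A ` H)"

definition projective_packing :: "('x::finite \<Rightarrow> 'x \<Rightarrow> bool) \<Rightarrow> ('x \<Rightarrow> 'h \<Rightarrow> 'h) \<Rightarrow> bool" where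
  "projective_packing adj R \<longleftrightarrow>
     (\<forall>x. projector (R x)) \<and> (\<forall>x y. adj x y \<longrightarrow> (\<forall>v\<in>H. R x (R y v) = 0))"

definition packing_val :: "('x::finite \<Rightarrow> 'h \<Rightarrow> 'h) \<Rightarrow> real" where
  "packing_val R = (\<Sum>x\<in>UNIV. real (op_rank (R x))) / real (dim H)"

text \<open>
  \<open>F\<close>, as a function from the vertices to operators on \<open>H\<close>, is an element
  \<open>\<Sum>i<k. f i \<otimes> A i\<close> of \<open>K \<otimes> End(H)\<close>.
\<close>

definition in_tensor_End :: "(complex^'x::finite) set \<Rightarrow> ('x \<Rightarrow> 'h \<Rightarrow> 'h) \<Rightarrow> bool" where
  "in_tensor_End K F \<longleftrightarrow>
     (\<exists>(k::nat) f A. (\<forall>i<k. f i \<in> K \<and> A i \<in> End) \<and>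
        (\<forall>x. \<forall>v\<in>H. F x v = (\<Sum>i<k. scale (f i $ x) (A i v))))"

text \<open>Entry in row \<open>b\<close> and column \<open>c\<close> of the matrix of \<open>A\<close> with respect to a basis \<open>B\<close> of \<open>H\<close>.\<close>

definition matrix_entry :: "'h set \<Rightarrow> ('h \<Rightarrow> 'h) \<Rightarrow> 'h \<Rightarrow> 'h \<Rightarrow> complex" where
  "matrix_entry B A b c = representation B (A c) b"

end

text \<open>
  The supremum over all nonzero finite-dimensional Hilbert spaces is taken over those inside the
  space of complex sequences, with arbitrary inner products; every such Hilbert space is
  isometrically isomorphic to one of these.
\<close>

definition seq_scale :: "complex \<Rightarrow> (nat \<Rightarrow> complex) \<Rightarrow> nat \<Rightarrow> complex" where
  "seq_scale c v = (\<lambda>i. c * v i)"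

definition projective_packing_number :: "('x::finite \<Rightarrow> 'x \<Rightarrow> bool) \<Rightarrow> real" where
  "projective_packing_number adj =
     Sup {fd_hilbert_space.packing_val seq_scale H R | H ip R.
            fd_hilbert_space seq_scale H ip \<and>
            fd_hilbert_space.projective_packing seq_scale H ip adj R}"

end

theory Submission
  imports Defs
begin

text \<open>
  The statement is complementary slackness for the inequality between the value of a projective
  packing and the value of a dual certificate. Let \<open>\<beta>\<close> be the common value and \<open>d = dim H\<close>, and put
  \<open>g x y = tr (R\<^sub>x R\<^sub>y)\<close>. Then \<open>g x x\<close> is the rank of \<open>R\<^sub>x\<close>, so that \<open>\<Sum>\<^sub>x g x x = \<beta> d\<close>. Moreover
  \<open>g x y \<ge> 0\<close> as a trace of a product of positive operators, and \<open>g x y = 0\<close> for adjacent vertices.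
  The constraints on the entries of \<open>Q\<close> therefore give
  \<open>\<Sum>\<^sub>x\<^sub>y Q\<^sub>x\<^sub>y g x y \<le> \<beta> \<Sum>\<^sub>x g x x - \<Sum>\<^sub>x\<^sub>y g x y = \<beta>\<^sup>2 d - tr (S\<^sup>2)\<close> with \<open>S = \<Sum>\<^sub>x R\<^sub>x\<close>. As \<open>S\<close> has
  trace \<open>\<beta> d\<close>, expanding \<open>0 \<le> tr ((S - \<beta> I)\<^sup>2)\<close> shows that the right-hand side is at most \<open>0\<close>
  (\<open>hs_sum_projectors_ge\<close>).

  On the other hand, in an orthonormal basis \<open>tr (R\<^sub>x R\<^sub>y)\<close> is the sum over all matrix positions
  of the product of an entry of \<open>R\<^sub>x\<close> with the conjugate of the same entry of \<open>R\<^sub>y\<close>. Hence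
  \<open>\<Sum>\<^sub>x\<^sub>y Q\<^sub>x\<^sub>y g x y\<close> is the sum over all positions of the quadratic form of \<open>Q\<close> at the
  corresponding entry function. Each of these terms is nonnegative and their sum is not positive,
  so each is zero, and a vector on which a positive semidefinite form vanishes lies in the kernel
  (\<open>tight_gram_family_in_kernel\<close>).

  The entries in one orthonormal basis being in the kernel yields the tensor decomposition
  through matrix units, and this decomposition in turn controls the entries in an arbitrary basis.
\<close>

section \<open>Tight families for a dual certificate\<close>

text \<open>
  Perturbing \<open>u\<close> in the direction \<open>w = Q u\<close> changes the form by \<open>2 t \<parallel>w\<parallel>\<^sup>2\<close> to first order in \<open>t\<close>,
  so that a small negative \<open>t\<close> would make it negative if \<open>w\<close> were not zero.
\<close>

lemma psd_kernel_if_form_zero: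
  fixes Q :: "real^'x^'x::finite"
  assumes sym: "transpose Q = Q" and psd: "\<And>v. 0 \<le> v \<bullet> (Q *v v)" and zero: "u \<bullet> (Q *v u) = 0"
  shows "Q *v u = 0"
proof -
  define w where "w = Q *v u"
  define a where "a = w \<bullet> w"
  define b where "b = w \<bullet> (Q *v w)"
  have b: "b \<ge> 0" unfolding b_def by (rule psd)
  have uw: "u \<bullet> (Q *v w) = a"
    by (metis a_def dot_lmul_matrix sym transpose_matrix_vector w_def)
  have form: "(u + t *\<^sub>R w) \<bullet> (Q *v (u + t *\<^sub>R w)) = 2 * t * a + t\<^sup>2 * b" for t
    using zero uw
    by (simp add: matrix_vector_right_distrib matrix_vector_mult_scaleR inner_add_left
        inner_add_right a_def b_def w_def[symmetric] power2_eq_square algebra_simps)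
  \<comment> \<open>The minimizer \<open>- a / b\<close> is replaced by \<open>- a / (b + 1)\<close>, which also serves when \<open>b = 0\<close>.\<close>
  have "0 \<le> 2 * (- a / (b + 1)) * a + (- a / (b + 1))\<^sup>2 * b"
    using psd form by metis
  also have "\<dots> = - (a\<^sup>2 * (b + 2) / (b + 1)\<^sup>2)"
    using b by (simp add: divide_simps) (simp add: power2_eq_square algebra_simps)
  finally have "a\<^sup>2 * (b + 2) / (b + 1)\<^sup>2 \<le> 0" by simp
  moreover have "(b + 2) / (b + 1)\<^sup>2 > 0" using b by (simp add: add_nonneg_pos)
  ultimately have "a\<^sup>2 \<le> 0"
    by (metis linorder_not_le mult_pos_pos times_divide_eq_right)
  then show ?thesis by (simp add: a_def w_def)
qed

lemma complex_kerI:
  fixes Q :: "real^'x^'x::finite"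
  assumes "Q *v (\<chi> x. Re (f $ x)) = 0" and "Q *v (\<chi> x. Im (f $ x)) = 0"
  shows "f \<in> complex_ker Q"
  using assms
  by (simp add: complex_ker_def vec_eq_iff matrix_vector_mult_def complex_eq_iff)

lemma sum_mem_complex_ker:
  assumes "\<And>i. i \<in> I \<Longrightarrow> f i \<in> complex_ker Q"
  shows "(\<chi> x. \<Sum>i\<in>I. f i $ x * c i) \<in> complex_ker Q"
proof -
  have "(\<Sum>y\<in>UNIV. complex_of_real (Q $ x $ y) * (\<Sum>i\<in>I. f i $ y * c i)) = 0" for x
  proof -
    have "(\<Sum>y\<in>UNIV. complex_of_real (Q $ x $ y) * (\<Sum>i\<in>I. f i $ y * c i))
        = (\<Sum>i\<in>I. (\<Sum>y\<in>UNIV. complex_of_real (Q $ x $ y) * f i $ y) * c i)"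
      unfolding sum_distrib_left sum_distrib_right
      by (subst sum.swap) (simp add: mult.assoc)
    also have "\<dots> = 0"
      using assms by (intro sum.neutral) (auto simp: complex_ker_def vec_eq_iff matrix_vector_mult_def)
    finally show ?thesis .
  qed
  then show ?thesis by (simp add: complex_ker_def vec_eq_iff matrix_vector_mult_def)
qed

text \<open>
  Pairing a certificate with a Gram matrix \<open>g\<close> that is entrywise nonnegative and vanishes on edges
  gives at most \<open>\<beta>\<close> times the trace of \<open>g\<close> minus the sum of its entries. Hypothesis
  \<open>tight\<close> makes this nonpositive, while the pairing is a sum of values of the form of \<open>Q\<close> at the
  vectors of the family. As \<open>Q\<close> is real, the form at a complex vector splits into its values at the
  real and the imaginary part.
\<close>

lemma tight_gram_family_in_kernel:
  fixes f :: "'i \<Rightarrow> complex^'x::finite" and Q :: "real^'x^'x"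
  assumes cert: "dual_certificate adj \<beta> Q" and fin: "finite I"
    and gram: "\<And>x y. g x y = (\<Sum>i\<in>I. Re (f i $ x * cnj (f i $ y)))"
    and nonneg: "\<And>x y. 0 \<le> g x y"
    and adj_zero: "\<And>x y. adj x y \<Longrightarrow> g x y = 0"
    and tight: "\<beta> * (\<Sum>x\<in>UNIV. g x x) \<le> (\<Sum>x\<in>UNIV. \<Sum>y\<in>UNIV. g x y)"
    and i: "i \<in> I"
  shows "f i \<in> complex_ker Q"
proof -
  have sym: "transpose Q = Q" and psd: "\<And>v. 0 \<le> v \<bullet> (Q *v v)"
    and diag: "\<And>x. Q $ x $ x = \<beta> - 1"
    and off: "\<And>x y. x \<noteq> y \<Longrightarrow> \<not> adj x y \<Longrightarrow> Q $ x $ y \<le> - 1"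
    using cert by (auto simp: dual_certificate_def)
  define q where "q v = v \<bullet> (Q *v v)" for v :: "real^'x"
  define re where "re j = (\<chi> x. Re (f j $ x))" for j
  define im where "im j = (\<chi> x. Im (f j $ x))" for j
  have "(\<Sum>j\<in>I. q (re j) + q (im j)) = (\<Sum>x\<in>UNIV. \<Sum>y\<in>UNIV. Q $ x $ y * g x y)"
  proof -
    have "q (re j) + q (im j)
        = (\<Sum>x\<in>UNIV. \<Sum>y\<in>UNIV. Q $ x $ y * Re (f j $ x * cnj (f j $ y)))" for j
      by (simp add: q_def re_def im_def inner_vec_def matrix_vector_mult_def sum_distrib_left
          sum.distrib[symmetric] algebra_simps)
    then have "(\<Sum>j\<in>I. q (re j) + q (im j))
        = (\<Sum>j\<in>I. \<Sum>x\<in>UNIV. \<Sum>y\<in>UNIV. Q $ x $ y * Re (f j $ x * cnj (f j $ y)))"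
      by simp
    also have "\<dots> = (\<Sum>x\<in>UNIV. \<Sum>y\<in>UNIV. \<Sum>j\<in>I. Q $ x $ y * Re (f j $ x * cnj (f j $ y)))"
      by (subst sum.swap, rule sum.cong, rule refl, rule sum.swap)
    finally show ?thesis by (simp only: gram sum_distrib_left)
  qed
  also have "\<dots> \<le> (\<Sum>x\<in>UNIV. \<Sum>y\<in>UNIV. (if x = y then \<beta> * g x x else 0) - g x y)"
  proof (intro sum_mono)
    fix x y
    show "Q $ x $ y * g x y \<le> (if x = y then \<beta> * g x x else 0) - g x y"
      using mult_right_mono[OF off nonneg, of x y x y] adj_zero[of x y]
      by (cases "x = y"; cases "adj x y") (auto simp: diag algebra_simps)
  qed
  also have "\<dots> = \<beta> * (\<Sum>x\<in>UNIV. g x x) - (\<Sum>x\<in>UNIV. \<Sum>y\<in>UNIV. g x y)"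
    by (simp add: sum_subtractf sum_distrib_left)
  also have "\<dots> \<le> 0" using tight by simp
  finally have le0: "(\<Sum>j\<in>I. q (re j) + q (im j)) \<le> 0" .
  have q_nonneg: "0 \<le> q v" for v unfolding q_def by (rule psd)
  have "(\<Sum>j\<in>I. q (re j) + q (im j)) = 0"
    using le0 by (intro antisym sum_nonneg) (auto intro: add_nonneg_nonneg q_nonneg)
  then have "q (re i) + q (im i) = 0"
    using fin i by (subst (asm) sum_nonneg_eq_0_iff) (auto intro: add_nonneg_nonneg q_nonneg)
  then have "q (re i) = 0" "q (im i) = 0"
    using q_nonneg[of "re i"] q_nonneg[of "im i"] by linarith+
  then show ?thesis
    using psd_kernel_if_form_zero[OF sym psd] by (auto simp: q_def re_def im_def intro!: complex_kerI)
qed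

section \<open>Orthonormal bases\<close>

context fd_hilbert_space
begin

lemma ip_zero_left: "v \<in> H \<Longrightarrow> ip 0 v = 0"
  using ip_scale_left[of v v 0] by simp

lemma ip_sum_left:
  assumes "finite I" "\<And>i. i \<in> I \<Longrightarrow> u i \<in> H" "v \<in> H"
  shows "ip (sum u I) v = (\<Sum>i\<in>I. ip (u i) v)"
  using assms
  by (induction I) (auto simp: ip_zero_left ip_add_left subspace_sum[OF subspace_H])

lemma ip_sum_right:
  assumes "finite I" "\<And>i. i \<in> I \<Longrightarrow> u i \<in> H" "v \<in> H"
  shows "ip v (sum u I) = (\<Sum>i\<in>I. ip v (u i))"
  using assms ip_sum_left[OF assms] subspace_sum[OF subspace_H, of I u]
  by (subst ip_commute) (auto intro!: sum.cong simp: ip_commute[symmetric])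

lemma ip_scale_right: "\<lbrakk>u \<in> H; v \<in> H\<rbrakk> \<Longrightarrow> ip u (scale c v) = cnj c * ip u v"
  using ip_commute[of "scale c v" u] ip_commute[of v u] ip_scale_left[of v u c]
    subspace_scale[OF subspace_H] by simp

lemma ip_diff_left: "\<lbrakk>u \<in> H; v \<in> H; w \<in> H\<rbrakk> \<Longrightarrow> ip (u - v) w = ip u w - ip v w"
  using ip_add_left[of "u - v" v w] subspace_diff[OF subspace_H] by (simp add: algebra_simps)

lemma ip_self_real: "v \<in> H \<Longrightarrow> ip v v = of_real (Re (ip v v))"
  using ip_commute[of v v] by (simp add: complex_eq_iff)

lemma ip_self_nonneg: "v \<in> H \<Longrightarrow> 0 \<le> Re (ip v v)"
  using ip_pos[of v] ip_zero_left[of v] by (cases "v = 0") auto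

text \<open>Finiteness is included because the expansions below sum over the whole set.\<close>

definition orthonormal :: "'h set \<Rightarrow> bool" where
  "orthonormal E \<longleftrightarrow> finite E \<and> E \<subseteq> H \<and> (\<forall>e\<in>E. \<forall>e'\<in>E. ip e e' = (if e = e' then 1 else 0))"

lemma orthonormal_expansion:
  assumes on: "orthonormal E" and v: "v \<in> span E"
  shows "v = (\<Sum>e\<in>E. scale (ip v e) e)"
proof -
  from on have fin: "finite E" and sub: "E \<subseteq> H" by (auto simp: orthonormal_def)
  from v fin obtain c where c: "v = (\<Sum>e\<in>E. scale (c e) e)"
    by (auto simp: span_finite)
  have "ip v e = c e" if "e \<in> E" for e
  proof -
    have "ip v e = (\<Sum>e'\<in>E. c e' * ip e' e)"
      unfolding c using that sub fin
      by (subst ip_sum_left)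
        (auto intro!: sum.cong ip_scale_left subspace_scale[OF subspace_H])
    also have "\<dots> = (\<Sum>e'\<in>E. if e' = e then c e' else 0)"
      using on that by (intro sum.cong) (auto simp: orthonormal_def)
    finally show ?thesis using fin that by simp
  qed
  then show ?thesis by (simp add: c cong: sum.cong)
qed

lemma orthonormal_independent:
  assumes on: "orthonormal E"
  shows "independent E"
proof -
  from on have fin: "finite E" and sub: "E \<subseteq> H" by (auto simp: orthonormal_def)
  show ?thesis
  proof (rule independent_if_scalars_zero[OF fin])
    fix c e
    assume zero: "(\<Sum>e\<in>E. scale (c e) e) = 0" and e: "e \<in> E"
    have "0 = ip (\<Sum>e\<in>E. scale (c e) e) e"
      using zero e sub by (auto simp: ip_zero_left)
    also have "\<dots> = (\<Sum>e'\<in>E. c e' * ip e' e)"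
      using e sub fin
      by (subst ip_sum_left)
        (auto intro!: sum.cong ip_scale_left subspace_scale[OF subspace_H])
    also have "\<dots> = (\<Sum>e'\<in>E. if e' = e then c e' else 0)"
      using on e by (intro sum.cong) (auto simp: orthonormal_def)
    finally show "c e = 0" using fin e by simp
  qed
qed

text \<open>
  The classical procedure: subtract from the next vector its projection onto the span obtained so
  far, and normalize the remainder unless it vanishes.
\<close>

lemma Gram_Schmidt:
  assumes "finite B" "B \<subseteq> H"
  shows "\<exists>E. orthonormal E \<and> span E = span B"
  using assms
proof (induction B)
  case empty
  then show ?case by (intro exI[of _ "{}"]) (simp add: orthonormal_def)
next
  case (insert b B)
  then obtain E where on: "orthonormal E" and sp: "span E = span B" by auto
  from on have fin: "finite E" and sub: "E \<subseteq> H" by (auto simp: orthonormal_def)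
  have bH: "b \<in> H" using insert by auto
  define p where "p = (\<Sum>e\<in>E. scale (ip b e) e)"
  have p_span: "p \<in> span E"
    unfolding p_def by (intro span_sum span_scale span_base)
  have pH: "p \<in> H"
    unfolding p_def using sub by (intro subspace_sum[OF subspace_H] subspace_scale[OF subspace_H]) auto
  define u where "u = b - p"
  have uH: "u \<in> H" unfolding u_def using bH pH by (rule subspace_diff[OF subspace_H])
  have ortho: "ip u e = 0" if "e \<in> E" for e
  proof -
    have "ip p e = (\<Sum>e'\<in>E. ip b e' * ip e' e)"
      unfolding p_def using that sub fin
      by (subst ip_sum_left)
        (auto intro!: sum.cong ip_scale_left subspace_scale[OF subspace_H])
    also have "\<dots> = (\<Sum>e'\<in>E. if e' = e then ip b e' else 0)"
      using on that by (intro sum.cong) (auto simp: orthonormal_def)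
    finally have "ip p e = ip b e" using fin that by simp
    then show ?thesis unfolding u_def using that sub bH pH by (subst ip_diff_left) auto
  qed
  show ?case
  proof (cases "u = 0")
    case True
    then have "b \<in> span B" using p_span sp by (simp add: u_def)
    then show ?thesis using on sp by (metis span_redundant)
  next
    case False
    define n where "n = sqrt (Re (ip u u))"
    have pos: "Re (ip u u) > 0" using ip_pos[OF uH False] .
    then have n: "n > 0" "n * n = Re (ip u u)" by (auto simp: n_def)
    define w where "w = scale (of_real (1 / n)) u"
    have wH: "w \<in> H" unfolding w_def using uH by (rule subspace_scale[OF subspace_H])
    have ww: "ip w w = 1"
    proof -
      have "ip w w = of_real (1 / n) * (of_real (1 / n) * of_real (n * n))"
        unfolding w_def using uH ip_self_real[OF uH] n(2)
        by (simp add: ip_scale_left ip_scale_right subspace_scale[OF subspace_H])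
      also have "\<dots> = 1" using n(1) by simp
      finally show ?thesis .
    qed
    have we: "ip w e = 0" "ip e w = 0" if "e \<in> E" for e
    proof -
      have eH: "e \<in> H" using that sub by auto
      show "ip w e = 0" using ortho[OF that] uH eH by (simp add: w_def ip_scale_left)
      then show "ip e w = 0" using ip_commute[OF wH eH] by simp
    qed
    have "orthonormal (insert w E)"
      using on wH ww we unfolding orthonormal_def by auto
    moreover have "span (insert w E) = span (insert b B)"
    proof -
      have "b = scale (of_real n) w + p" using n(1) by (simp add: w_def u_def)
      moreover have "scale (of_real n) w + p \<in> span (insert w E)"
        using p_span span_mono[of E "insert w E"]
        by (intro span_add span_scale) (auto intro: span_base)
      ultimately have b_span: "b \<in> span (insert w E)" by simp
      have p': "p \<in> span (insert b B)" using p_span sp span_mono[of B "insert b B"] by auto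
      have w_span: "w \<in> span (insert b B)"
        unfolding w_def u_def using p' by (intro span_scale span_diff) (auto intro: span_base)
      have "insert w E \<subseteq> span (insert b B)"
        using w_span sp span_superset[of E] span_mono[of B "insert b B"] by blast
      moreover have "insert b B \<subseteq> span (insert w E)"
        using b_span sp span_superset[of B] span_mono[of E "insert w E"] by blast
      ultimately show ?thesis by (metis span_eq)
    qed
    ultimately show ?thesis by blast
  qed
qed

lemma orthonormal_basis_exists:
  assumes "subspace W" "W \<subseteq> H"
  obtains E where "orthonormal E" "span E = W" "dim W = card E"
proof -
  obtain B where B: "B \<subseteq> W" "independent B" "W \<subseteq> span B"
    using maximal_independent_subset by blast
  obtain C where C: "finite C" "span C = H" using finite_dim_H by blast
  have "B \<subseteq> span C" using B(1) assms(2) C(2) by blast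
  then have "finite B" using independent_span_bound[OF C(1) B(2)] by blast
  moreover have "B \<subseteq> H" using B(1) assms(2) by blast
  ultimately obtain E where E: "orthonormal E" "span E = span B" using Gram_Schmidt by blast
  have "span B = W" using B span_minimal[OF _ assms(1)] by blast
  then show thesis
    using that[of E] E dim_span_eq_card_independent[OF orthonormal_independent[OF E(1)]] by simp
qed

lemma Parseval:
  assumes on: "orthonormal E" and sp: "span E = H" and "u \<in> H" "v \<in> H"
  shows "ip u v = (\<Sum>e\<in>E. ip u e * cnj (ip v e))"
proof -
  from on have fin: "finite E" and sub: "E \<subseteq> H" by (auto simp: orthonormal_def)
  have "ip u v = ip u (\<Sum>e\<in>E. scale (ip v e) e)"
    using orthonormal_expansion[OF on] assms by simp
  also have "\<dots> = (\<Sum>e\<in>E. ip u (scale (ip v e) e))"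
    using fin sub \<open>u \<in> H\<close> subspace_scale[OF subspace_H] by (intro ip_sum_right) auto
  also have "\<dots> = (\<Sum>e\<in>E. ip u e * cnj (ip v e))"
    using sub assms by (intro sum.cong) (auto simp: ip_scale_right)
  finally show ?thesis .
qed

section \<open>The Hilbert-Schmidt product of projectors\<close>

text \<open>
  An orthonormal basis \<open>F\<close> of the range of \<open>P\<close> expands \<open>P v\<close> with coefficients \<open>ip (P v) f\<close>; these
  equal \<open>ip v f\<close> since \<open>P\<close> is self-adjoint and fixes \<open>f\<close>. The rank enters the argument only through
  the cardinality of \<open>F\<close>.
\<close>

lemma projector_expansion:
  assumes proj: "projector P"
  obtains F where "orthonormal F" "op_rank P = card F"
    "\<And>v. v \<in> H \<Longrightarrow> P v = (\<Sum>f\<in>F. scale (ip v f) f)"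
proof -
  have mem: "P v \<in> H" and idem: "P (P v) = P v" if "v \<in> H" for v
    using proj that by (auto simp: projector_def End_def)
  have adj: "ip (P u) v = ip u (P v)" if "u \<in> H" "v \<in> H" for u v
    using proj that by (auto simp: projector_def)
  have add: "P (u + v) = P u + P v" if "u \<in> H" "v \<in> H" for u v
    using proj that by (auto simp: projector_def End_def)
  have scl: "P (scale c v) = scale c (P v)" if "v \<in> H" for c v
    using proj that by (auto simp: projector_def End_def)
  have "subspace (P ` H)"
    unfolding subspace_def
  proof (intro conjI ballI allI)
    show "0 \<in> P ` H"
      using scl[of 0 0] subspace_0[OF subspace_H] by (force simp: image_iff)
  next
    fix u v assume "u \<in> P ` H" "v \<in> P ` H"
    then show "u + v \<in> P ` H"
      using add subspace_add[OF subspace_H] by (auto simp: image_iff) metis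
  next
    fix c v assume "v \<in> P ` H"
    then show "scale c v \<in> P ` H"
      using scl subspace_scale[OF subspace_H] by (auto simp: image_iff) metis
  qed
  moreover have "P ` H \<subseteq> H" using mem by blast
  ultimately obtain F where F: "orthonormal F" "span F = P ` H" "dim (P ` H) = card F"
    by (rule orthonormal_basis_exists)
  have fix_F: "f \<in> H" "P f = f" if "f \<in> F" for f
  proof -
    have "f \<in> P ` H" using that F(2) span_base by blast
    then show "f \<in> H" "P f = f" using mem idem by auto
  qed
  have "P v = (\<Sum>f\<in>F. scale (ip v f) f)" if v: "v \<in> H" for v
  proof -
    have "P v = (\<Sum>f\<in>F. scale (ip (P v) f) f)"
      using F v by (intro orthonormal_expansion) auto
    also have "\<dots> = (\<Sum>f\<in>F. scale (ip v f) f)"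
      using adj[OF v] fix_F by (intro sum.cong) auto
    finally show ?thesis .
  qed
  then show thesis using that F by (simp add: op_rank_def)
qed

text \<open>
  For self-adjoint operators, and \<open>E\<close> an orthonormal basis of \<open>H\<close>, this is \<open>tr (A B)\<close>.
\<close>

definition hs :: "'h set \<Rightarrow> ('h \<Rightarrow> 'h) \<Rightarrow> ('h \<Rightarrow> 'h) \<Rightarrow> complex" where
  "hs E A B = (\<Sum>e\<in>E. ip (A e) (B e))"

text \<open>
  A projector is a sum of rank-one projectors, and two rank-one projectors onto unit vectors
  \<open>f\<close> and \<open>g\<close> have Hilbert-Schmidt product \<open>cmod (ip f g)\<^sup>2\<close>, by Parseval's identity for \<open>ip g f\<close>. Written this way,
  the product is visibly nonnegative, and for equal projectors it counts the vectors of \<open>F\<close>.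
\<close>

lemma hs_expansion:
  assumes E: "orthonormal E" "span E = H"
    and F: "orthonormal F" "\<And>v. v \<in> H \<Longrightarrow> A v = (\<Sum>f\<in>F. scale (ip v f) f)"
    and G: "orthonormal G" "\<And>v. v \<in> H \<Longrightarrow> B v = (\<Sum>g\<in>G. scale (ip v g) g)"
  shows "hs E A B = (\<Sum>f\<in>F. \<Sum>g\<in>G. of_real ((cmod (ip f g))\<^sup>2))"
proof -
  have sub: "E \<subseteq> H" "F \<subseteq> H" "G \<subseteq> H" and fin: "finite F" "finite G"
    using E F G by (auto simp: orthonormal_def)
  have "ip (A e) (B e) = (\<Sum>f\<in>F. \<Sum>g\<in>G. ip f g * (ip g e * cnj (ip f e)))" if "e \<in> E" for e
  proof -
    have e: "e \<in> H" using that sub by auto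
    have mem: "scale c f \<in> H" if "f \<in> F \<union> G" for c f
      using that sub by (auto intro: subspace_scale[OF subspace_H])
    have "B e \<in> H" using G(2)[OF e] mem by (auto intro!: subspace_sum[OF subspace_H])
    then have "ip (A e) (B e) = (\<Sum>f\<in>F. ip (scale (ip e f) f) (B e))"
      using F(2)[OF e] fin mem by (simp add: ip_sum_left)
    also have "\<dots> = (\<Sum>f\<in>F. \<Sum>g\<in>G. ip (scale (ip e f) f) (scale (ip e g) g))"
      using G(2)[OF e] fin mem by (intro sum.cong refl) (simp add: ip_sum_right)
    also have "\<dots> = (\<Sum>f\<in>F. \<Sum>g\<in>G. ip f g * (ip g e * cnj (ip f e)))"
    proof (intro sum.cong refl)
      fix f g assume "f \<in> F" "g \<in> G"
      then have "f \<in> H" "g \<in> H" using sub by auto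
      then show "ip (scale (ip e f) f) (scale (ip e g) g) = ip f g * (ip g e * cnj (ip f e))"
        using e ip_commute[of e f] ip_commute[of e g]
        by (simp add: ip_scale_left ip_scale_right subspace_scale[OF subspace_H])
    qed
    finally show ?thesis .
  qed
  then have "hs E A B = (\<Sum>e\<in>E. \<Sum>f\<in>F. \<Sum>g\<in>G. ip f g * (ip g e * cnj (ip f e)))"
    by (simp add: hs_def)
  also have "\<dots> = (\<Sum>f\<in>F. \<Sum>g\<in>G. \<Sum>e\<in>E. ip f g * (ip g e * cnj (ip f e)))"
    by (subst sum.swap, rule sum.cong, rule refl, rule sum.swap)
  also have "\<dots> = (\<Sum>f\<in>F. \<Sum>g\<in>G. ip f g * ip g f)"
  proof (intro sum.cong refl)
    fix f g assume "f \<in> F" "g \<in> G"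
    then have "ip g f = (\<Sum>e\<in>E. ip g e * cnj (ip f e))" using sub by (intro Parseval[OF E]) auto
    then show "(\<Sum>e\<in>E. ip f g * (ip g e * cnj (ip f e))) = ip f g * ip g f"
      by (simp only: sum_distrib_left)
  qed
  also have "\<dots> = (\<Sum>f\<in>F. \<Sum>g\<in>G. of_real ((cmod (ip f g))\<^sup>2))"
  proof (intro sum.cong refl)
    fix f g assume "f \<in> F" "g \<in> G"
    then have "ip g f = cnj (ip f g)" using sub by (intro ip_commute) auto
    then show "ip f g * ip g f = of_real ((cmod (ip f g))\<^sup>2)"
      by (simp add: complex_norm_square[symmetric])
  qed
  finally show ?thesis .
qed

lemma hs_projectors_nonneg:
  assumes "orthonormal E" "span E = H" "projector P" "projector P'"
  shows "0 \<le> Re (hs E P P')"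
proof -
  obtain F where F: "orthonormal F" "\<And>v. v \<in> H \<Longrightarrow> P v = (\<Sum>f\<in>F. scale (ip v f) f)"
    using projector_expansion[OF assms(3)] by metis
  obtain G where G: "orthonormal G" "\<And>v. v \<in> H \<Longrightarrow> P' v = (\<Sum>f\<in>G. scale (ip v f) f)"
    using projector_expansion[OF assms(4)] by metis
  show ?thesis
    by (subst hs_expansion[OF assms(1,2) F G]) (simp_all add: sum_nonneg flip: of_real_sum)
qed

lemma hs_projector_self:
  assumes "orthonormal E" "span E = H" "projector P"
  shows "hs E P P = of_nat (op_rank P)"
proof -
  obtain F where F: "orthonormal F" "\<And>v. v \<in> H \<Longrightarrow> P v = (\<Sum>f\<in>F. scale (ip v f) f)"
    and r: "op_rank P = card F"
    using projector_expansion[OF assms(3)] by metis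
  have fin: "finite F" using F(1) by (simp add: orthonormal_def)
  have "hs E P P = (\<Sum>f\<in>F. \<Sum>g\<in>F. of_real ((cmod (ip f g))\<^sup>2))"
    by (rule hs_expansion[OF assms(1,2) F F])
  also have "\<dots> = (\<Sum>f\<in>F. \<Sum>g\<in>F. if f = g then 1 else 0)"
    using F(1) by (intro sum.cong) (auto simp: orthonormal_def)
  finally show ?thesis using fin r by simp
qed

text \<open>
  This is \<open>0 \<le> tr ((S - b I)\<^sup>2)\<close> for the sum \<open>S\<close> of the projectors, expanded; it replaces the
  Cauchy-Schwarz inequality \<open>(tr S)\<^sup>2 \<le> d tr (S\<^sup>2)\<close>. It is proved one basis vector at a time, from
  the nonnegativity of the squared norm of \<open>S e - b e\<close>.
\<close>

lemma hs_sum_projectors_ge: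
  fixes R :: "'x::finite \<Rightarrow> 'h \<Rightarrow> 'h"
  assumes E: "orthonormal E" "span E = H" and proj: "\<And>x. projector (R x)"
  shows "2 * b * (\<Sum>x\<in>UNIV. Re (hs E (R x) (R x))) - b\<^sup>2 * real (card E)
    \<le> (\<Sum>x\<in>UNIV. \<Sum>y\<in>UNIV. Re (hs E (R x) (R y)))"
proof -
  have sub: "E \<subseteq> H" using E by (auto simp: orthonormal_def)
  have mem: "R x v \<in> H" if "v \<in> H" for x v
    using proj[of x] that by (auto simp: projector_def End_def)
  have pointwise: "2 * b * (\<Sum>x\<in>UNIV. Re (ip (R x e) (R x e))) - b\<^sup>2
      \<le> (\<Sum>x\<in>UNIV. \<Sum>y\<in>UNIV. Re (ip (R x e) (R y e)))" if "e \<in> E" for e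
  proof -
    have e: "e \<in> H" and ee: "ip e e = 1" using that sub E by (auto simp: orthonormal_def)
    define s where "s = (\<Sum>x\<in>UNIV. R x e)"
    have s: "s \<in> H" unfolding s_def using mem[OF e] by (intro subspace_sum[OF subspace_H])
    have be: "scale (of_real b) e \<in> H" using e by (rule subspace_scale[OF subspace_H])
    have se: "ip s e = (\<Sum>x\<in>UNIV. ip (R x e) (R x e))"
    proof -
      have "ip (R x e) e = ip (R x e) (R x e)" for x
        using proj[of x] e mem[OF e] by (metis projector_def)
      then show ?thesis unfolding s_def using mem[OF e] e by (simp add: ip_sum_left)
    qed
    have ss: "ip s s = (\<Sum>x\<in>UNIV. \<Sum>y\<in>UNIV. ip (R x e) (R y e))"
    proof -
      have "ip s s = (\<Sum>x\<in>UNIV. ip (R x e) s)"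
        using s mem[OF e] by (subst (1) s_def) (simp add: ip_sum_left)
      also have "\<dots> = (\<Sum>x\<in>UNIV. \<Sum>y\<in>UNIV. ip (R x e) (R y e))"
        unfolding s_def using mem[OF e] by (simp add: ip_sum_right)
      finally show ?thesis .
    qed
    have "0 \<le> Re (ip (s - scale (of_real b) e) (s - scale (of_real b) e))"
      using s be by (intro ip_self_nonneg subspace_diff[OF subspace_H])
    also have "ip (s - scale (of_real b) e) (s - scale (of_real b) e)
        = ip s s - of_real b * ip s e - of_real b * cnj (ip s e) + of_real (b\<^sup>2)"
    proof -
      have "ip u (s - scale (of_real b) e) = ip u s - of_real b * ip u e" if "u \<in> H" for u
      proof -
        have "ip u (s - scale (of_real b) e) = cnj (ip s u - of_real b * ip e u)"
          using that s e be subspace_diff[OF subspace_H s be]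
          by (subst ip_commute[of _ u]) (auto simp: ip_diff_left ip_scale_left)
        then show ?thesis using that s e ip_commute[of u s] ip_commute[of u e] by simp
      qed
      note right = this
      have "ip (s - scale (of_real b) e) (s - scale (of_real b) e)
          = ip s (s - scale (of_real b) e) - of_real b * ip e (s - scale (of_real b) e)"
        using s e be subspace_diff[OF subspace_H s be] by (simp add: ip_diff_left ip_scale_left)
      also have "\<dots> = ip s s - of_real b * ip s e - of_real b * (ip e s - of_real b * ip e e)"
        by (simp only: right[OF s] right[OF e])
      finally show ?thesis
        using ee ip_commute[OF s e] by (simp add: algebra_simps power2_eq_square)
    qed
    finally have "0 \<le> Re (ip s s) - 2 * b * Re (ip s e) + b\<^sup>2"
      by (simp add: power2_eq_square)
    then show ?thesis unfolding se ss by simp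
  qed
  have "2 * b * (\<Sum>x\<in>UNIV. Re (hs E (R x) (R x))) - b\<^sup>2 * real (card E)
     = (\<Sum>e\<in>E. 2 * b * (\<Sum>x\<in>UNIV. Re (ip (R x e) (R x e))) - b\<^sup>2)"
    unfolding hs_def Re_sum
    by (subst sum.swap) (simp add: sum_subtractf sum_distrib_left)
  also have "\<dots> \<le> (\<Sum>e\<in>E. \<Sum>x\<in>UNIV. \<Sum>y\<in>UNIV. Re (ip (R x e) (R y e)))"
    by (intro sum_mono pointwise)
  also have "\<dots> = (\<Sum>x\<in>UNIV. \<Sum>y\<in>UNIV. Re (hs E (R x) (R y)))"
    unfolding hs_def Re_sum
    by (subst sum.swap, rule sum.cong, rule refl, rule sum.swap)
  finally show ?thesis .
qed

section \<open>Elements of the tensor product\<close>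

text \<open>
  The decomposition over matrix units: each pair \<open>(e, e')\<close> contributes the entry function
  \<open>x \<mapsto> ip (F x e) e'\<close> tensored with the operator taking \<open>v\<close> to \<open>ip v e\<close> times \<open>e'\<close>. The bijection
  \<open>h\<close> only numbers the pairs.
\<close>

lemma in_tensor_End_if_entries:
  assumes E: "orthonormal E" "span E = H" and F: "\<And>x. F x \<in> End"
    and entries: "\<And>e e'. e \<in> E \<Longrightarrow> e' \<in> E \<Longrightarrow> (\<chi> x. ip (F x e) e') \<in> K"
  shows "in_tensor_End K F"
proof -
  have fin: "finite E" and sub: "E \<subseteq> H" using E by (auto simp: orthonormal_def)
  define k where "k = card (E \<times> E)"
  obtain h where h: "bij_betw h {..<k} (E \<times> E)"
    using ex_bij_betw_nat_finite[of "E \<times> E"] fin by (auto simp: k_def atLeast0LessThan)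
  define f where "f i = (\<chi> x. ip (F x (fst (h i))) (snd (h i)))" for i
  define A where "A i v = scale (ip v (fst (h i))) (snd (h i))" for i v
  have hE: "fst (h i) \<in> E" "snd (h i) \<in> E" if "i < k" for i
    using bij_betwE[OF h] that by (auto simp: mem_Times_iff)
  have "f i \<in> K" "A i \<in> End" if "i < k" for i
  proof -
    show "f i \<in> K" using entries hE[OF that] by (simp add: f_def)
    have "fst (h i) \<in> H" "snd (h i) \<in> H" using hE[OF that] sub by auto
    then show "A i \<in> End"
      unfolding End_def A_def
      by (auto simp: ip_add_left ip_scale_left scale_left_distrib subspace_scale[OF subspace_H])
  qed
  moreover have "F x v = (\<Sum>i<k. scale (f i $ x) (A i v))" if v: "v \<in> H" for x v
  proof -
    have mem: "F x u \<in> H" if "u \<in> H" for u using F[of x] that by (auto simp: End_def)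
    have add: "F x (u + w) = F x u + F x w" if "u \<in> H" "w \<in> H" for u w
      using F[of x] that by (auto simp: End_def)
    have scl: "F x (scale c w) = scale c (F x w)" if "w \<in> H" for c w
      using F[of x] that by (auto simp: End_def)
    have F_sum: "F x (\<Sum>e\<in>D. scale (ip v e) e) = (\<Sum>e\<in>D. scale (ip v e) (F x e))"
      if "D \<subseteq> E" for D
      using finite_subset[OF that fin] that
    proof (induction D)
      case empty
      then show ?case using scl[of 0 0] subspace_0[OF subspace_H] by simp
    next
      case (insert d D)
      have "(\<Sum>e\<in>D. scale (ip v e) e) \<in> H"
        using insert.prems sub by (intro subspace_sum[OF subspace_H] subspace_scale[OF subspace_H]) auto
      moreover have "d \<in> H" using insert.prems sub by auto
      ultimately show ?case
        using insert by (simp add: add scl subspace_scale[OF subspace_H])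
    qed
    have "F x v = F x (\<Sum>e\<in>E. scale (ip v e) e)"
      using orthonormal_expansion[OF E(1)] v E(2) by simp
    also have "\<dots> = (\<Sum>e\<in>E. scale (ip v e) (F x e))"
      by (rule F_sum) simp
    also have "\<dots> = (\<Sum>e\<in>E. scale (ip v e) (\<Sum>e'\<in>E. scale (ip (F x e) e') e'))"
      using orthonormal_expansion[OF E(1)] E(2) mem sub by (intro sum.cong) auto
    also have "\<dots> = (\<Sum>(e, e')\<in>E \<times> E. scale (ip (F x e) e') (scale (ip v e) e'))"
      by (simp add: scale_sum_right sum.cartesian_product[symmetric] mult.commute)
    also have "\<dots> = (\<Sum>i<k. scale (f i $ x) (A i v))"
      by (subst sum.reindex_bij_betw[OF h, symmetric]) (simp add: f_def A_def case_prod_beta)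
    finally show ?thesis .
  qed
  ultimately show ?thesis unfolding in_tensor_End_def by blast
qed

text \<open>
  For fixed \<open>b\<close> and \<open>c\<close>, a matrix entry is a linear functional of the operator, so it maps a tensor
  \<open>\<Sum>i. f i \<otimes> A i\<close> to a linear combination of the functions \<open>f i\<close>.
\<close>

lemma matrix_entries_in_kernel:
  assumes F: "in_tensor_End (complex_ker Q) F" and B: "independent B" "span B = H"
    and c: "c \<in> B"
  shows "(\<chi> x. matrix_entry B (F x) b c) \<in> complex_ker Q"
proof -
  obtain k :: nat and f A where fA: "\<And>i. i < k \<Longrightarrow> f i \<in> complex_ker Q \<and> A i \<in> End"
    and F_eq: "\<And>x v. v \<in> H \<Longrightarrow> F x v = (\<Sum>i<k. scale (f i $ x) (A i v))"
    using F unfolding in_tensor_End_def by blast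
  have cH: "c \<in> H" using c B span_base by blast
  have A: "A i c \<in> span B" if "i < k" for i
    using fA[OF that] cH B by (auto simp: End_def)
  have "matrix_entry B (F x) b c = (\<Sum>i<k. f i $ x * representation B (A i c) b)" for x
    unfolding matrix_entry_def F_eq[OF cH] using A
    by (subst representation_sum[OF B(1)])
      (auto intro!: sum.cong simp: representation_scale[OF B(1)] span_scale)
  then show ?thesis
    using sum_mem_complex_ker[of "{..<k}" f Q] fA by simp
qed

section \<open>Optimal projective packings\<close>

text \<open>
  A packing whose value matches a certificate makes the family of its matrix entries, with Gram
  matrix \<open>tr (R\<^sub>x R\<^sub>y)\<close>, tight.
\<close>

lemma optimal_packing_entries_in_kernel:
  assumes pack: "projective_packing adj R"
    and cert: "dual_certificate adj (packing_val R) Q"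
    and E: "orthonormal E" "span E = H" and e: "e \<in> E" "e' \<in> E"
  shows "(\<chi> x. ip (R x e) e') \<in> complex_ker Q"
proof -
  have fin: "finite E" and sub: "E \<subseteq> H" using E by (auto simp: orthonormal_def)
  have proj: "projector (R x)" for x using pack by (simp add: projective_packing_def)
  have mem: "R x v \<in> H" if "v \<in> H" for x v
    using proj[of x] that by (auto simp: projector_def End_def)
  define f where "f p = (\<chi> x. ip (R x (fst p)) (snd p))" for p
  define g where "g x y = Re (hs E (R x) (R y))" for x y
  define d where "d = real (card E)"
  have d: "d > 0" using nonzero_H E fin by (auto simp: d_def card_gt_0_iff)
  have dim: "dim H = card E"
    using dim_span_eq_card_independent[OF orthonormal_independent[OF E(1)]] E(2) by simp
  have diag: "(\<Sum>x\<in>UNIV. g x x) = packing_val R * d"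
    using d by (simp add: g_def hs_projector_self[OF E proj] packing_val_def dim d_def)
  have "f (e, e') \<in> complex_ker Q"
  proof (rule tight_gram_family_in_kernel[OF cert, of "E \<times> E" g f])
    show "g x y = (\<Sum>p\<in>E \<times> E. Re (f p $ x * cnj (f p $ y)))" for x y
    proof -
      have "hs E (R x) (R y) = (\<Sum>a\<in>E. \<Sum>a'\<in>E. ip (R x a) a' * cnj (ip (R y a) a'))"
        unfolding hs_def using mem sub by (intro sum.cong refl Parseval[OF E]) auto
      then show ?thesis
        by (simp only: g_def f_def sum.cartesian_product case_prod_beta Re_sum vec_lambda_beta)
    qed
    show "0 \<le> g x y" for x y
      unfolding g_def by (rule hs_projectors_nonneg[OF E proj proj])
    show "g x y = 0" if "adj x y" for x y
    proof -
      have "ip (R x a) (R y a) = 0" if a: "a \<in> E" for a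
      proof -
        have aH: "a \<in> H" using a sub by auto
        have z: "R x (R y a) = 0" using pack \<open>adj x y\<close> aH by (simp add: projective_packing_def)
        have "ip (R x a) (R y a) = ip a (R x (R y a))"
          using proj[of x] aH mem[OF aH] by (simp add: projector_def)
        also have "\<dots> = cnj (ip 0 a)"
          using z aH ip_commute[of 0 a] subspace_0[OF subspace_H] by simp
        finally show ?thesis using aH by (simp add: ip_zero_left)
      qed
      then show ?thesis by (simp add: g_def hs_def)
    qed
    show "packing_val R * (\<Sum>x\<in>UNIV. g x x) \<le> (\<Sum>x\<in>UNIV. \<Sum>y\<in>UNIV. g x y)"
      using hs_sum_projectors_ge[where R=R, OF E proj, of "packing_val R"] diag
      by (simp add: g_def d_def power2_eq_square algebra_simps)
  qed (use fin e in auto)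
  then show ?thesis by (simp add: f_def)
qed

lemma optimal_packing_in_tensor_kernel:
  assumes pack: "projective_packing adj R"
    and cert: "dual_certificate adj (packing_val R) Q"
  shows "in_tensor_End (complex_ker Q) R"
proof -
  obtain E where E: "orthonormal E" "span E = H"
    using orthonormal_basis_exists[OF subspace_H] by blast
  have "R x \<in> End" for x using pack by (simp add: projective_packing_def projector_def)
  then show ?thesis
    using E optimal_packing_entries_in_kernel[OF pack cert E] by (intro in_tensor_End_if_entries)
qed

end

theorem theorem2p7:
  fixes adj :: "'x::finite \<Rightarrow> 'x \<Rightarrow> bool"
    and scale :: "complex \<Rightarrow> 'h::ab_group_add \<Rightarrow> 'h"
    and H :: "'h set"
    and ip :: "'h \<Rightarrow> 'h \<Rightarrow> complex"
    and R :: "'x \<Rightarrow> 'h \<Rightarrow> 'h"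
    and Q :: "real^'x^'x"
  assumes "symp adj" and "irreflp adj"
    and "projective_packing_number adj = theta_minus adj"
    and "fd_hilbert_space scale H ip"
    and "fd_hilbert_space.projective_packing scale H ip adj R"
    and "fd_hilbert_space.packing_val scale H R = projective_packing_number adj"
    and "dual_certificate adj (theta_minus adj) Q"
  shows "fd_hilbert_space.in_tensor_End scale H (complex_ker Q) R \<and>
         (\<forall>B. \<not> module.dependent scale B \<and> module.span scale B = H \<longrightarrow>
           (\<forall>b\<in>B. \<forall>c\<in>B.
              (\<chi> x. fd_hilbert_space.matrix_entry scale B (R x) b c) \<in> complex_ker Q))"
proof -
  interpret fd_hilbert_space scale H ip by fact
  have "in_tensor_End (complex_ker Q) R"
    using assms by (intro optimal_packing_in_tensor_kernel[of adj]) auto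
  then show ?thesis using matrix_entries_in_kernel by blast
qed

end
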